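(* Let $T>0$, $\nu\ge0$, $\mu\ge0$. For every integer $M\ge 0$ there exist a $2\pi$-periodic solution $u$ on $[0,T]$ of the Burgers equation $$u_t=\nu u_{xx}-u u_x$$ and an initialization $v_0\in L^2_{\mathrm{per}}$ such that the back-and-forth nudging sequence $(v^n,\tilde v^n)_{n\ge1}$ on $[0,T]$ given by $$v^n_t=\nu v^n_{xx}-v^n v^n_x+\mu P_M(u-v^n),\qquad v^n(0)=\tilde v^{n-1}(0),$$ $$\tilde v^n_t=\nu \tilde v^n_{xx}-\tilde v^n\tilde v^n_x-\mu P_M(u-\tilde v^n),\qquad \tilde v^n(T)=v^n(T),$$ for $n=1,2,\dots$, initialized with $v^1(0)=\tilde v^0(0)=v_0$, does not recover the initial condition of $u$, i.e. $$\limsup_{n\to\infty}\|\tilde v^n(0)-u(0)\|_{L^2_{\mathrm{per}}}>0.$$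
   Context: $L^2_{\mathrm{per}}$ is the space of $2\pi$-periodic functions on $\mathbb{R}$ that are square-integrable over a period, with norm $\|g\|_{L^2_{\mathrm{per}}}=\left(\int_0^{2\pi}|g|^2\,dx\right)^{1/2}$. $P_M$ is the projection of $L^2_{\mathrm{per}}$ onto the Fourier modes $e^{ikx}$ with $|k|\le M$. All equations are posed with $2\pi$-periodic boundary conditions in $x$, and solutions take values in $L^2_{\mathrm{per}}$ for $t\in[0,T]$; when $\nu=0$, solutions of the Burgers equation are assumed to be shock-free on $[0,T]$. The equation for $\tilde v^n$ is solved backward in time from the terminal condition at $t=T$. Standing assumption: existence and uniqueness of solutions to the forward ($v^n$) and backward ($\tilde v^n$) equations. *)

theory Defs
  imports "HOL-Analysis.Analysis"
begin

definition L2_per :: "(real \<Rightarrow> real) set" where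
  "L2_per = {g. (\<forall>x. g (x + 2 * pi) = g x) \<and> g \<in> borel_measurable lebesgue \<and>
                set_integrable lebesgue {0..2 * pi} (\<lambda>x. (g x)\<^sup>2)}"

definition L2_norm :: "(real \<Rightarrow> real) \<Rightarrow> real" where
  "L2_norm g = sqrt (LINT x:{0..2 * pi}|lebesgue. (g x)\<^sup>2)"

text \<open>Equality as elements of the space of classes of functions.\<close>

definition L2_eq :: "(real \<Rightarrow> real) \<Rightarrow> (real \<Rightarrow> real) \<Rightarrow> bool" where
  "L2_eq f g \<longleftrightarrow> (AE x in lebesgue. f x = g x)"

definition fourier_coeff :: "(real \<Rightarrow> real) \<Rightarrow> int \<Rightarrow> complex" where
  "fourier_coeff g k =
     (LINT y:{0..2 * pi}|lebesgue. complex_of_real (g y) * cis (- (of_int k * y))) / of_real (2 * pi)"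

text \<open>For real \<open>g\<close> the Fourier sum over the symmetric range of modes is real, so taking the
  real part loses nothing; this is the lemma below.\<close>

definition fourier_proj :: "nat \<Rightarrow> (real \<Rightarrow> real) \<Rightarrow> real \<Rightarrow> real" where
  "fourier_proj M g x = Re (\<Sum>k\<in>{- int M..int M}. fourier_coeff g k * cis (of_int k * x))"

lemma fourier_coeff_uminus: "fourier_coeff g (- k) = cnj (fourier_coeff g k)"
proof -
  have "cnj (LINT y:{0..2 * pi}|lebesgue. complex_of_real (g y) * cis (- (of_int k * y)))
      = (LINT y:{0..2 * pi}|lebesgue. complex_of_real (g y) * cis (of_int k * y))"
    unfolding set_lebesgue_integral_def
    by (subst Bochner_Integration.integral_cnj [symmetric]) (simp add: scaleR_conv_of_real cis_cnj)
  then show ?thesis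
    by (simp add: fourier_coeff_def)
qed

lemma of_real_fourier_proj:
  "complex_of_real (fourier_proj M g x) =
     (\<Sum>k\<in>{- int M..int M}. fourier_coeff g k * cis (of_int k * x))" (is "_ = ?S")
proof -
  have "cnj ?S = (\<Sum>k\<in>{- int M..int M}. fourier_coeff g (- k) * cis (of_int (- k) * x))"
    by (simp add: fourier_coeff_uminus cis_cnj)
  also have "\<dots> = ?S"
    by (rule sum.reindex_bij_witness [of _ uminus uminus]) auto
  finally have "?S \<in> \<real>"
    by (simp add: Reals_cnj_iff)
  then show ?thesis
    by (simp only: fourier_proj_def of_real_Re)
qed

text \<open>Times at which the equation has to hold pointwise. For positive viscosity the initial
  datum is merely square-integrable, so the equation is imposed in the interior and the end
  points are reached by continuity in the \<open>L2\<close> norm. For zero viscosity there is no smoothing,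
  and imposing continuous differentiability up to both end points is what excludes shocks on
  the closed interval.\<close>

definition pde_times :: "real \<Rightarrow> real \<Rightarrow> real set" where
  "pde_times \<nu> T = (if \<nu> = 0 then {0..T} else {0<..<T})"

text \<open>\<open>u t x\<close> solves \<open>u\<^sub>t = \<nu> u\<^sub>x\<^sub>x - u u\<^sub>x + F\<close>. The second space derivative is only required to
  exist if \<open>\<nu> \<noteq> 0\<close>; otherwise the witness \<open>uxx\<close> is irrelevant.\<close>

definition forced_burgers_solution ::
  "real \<Rightarrow> real \<Rightarrow> (real \<Rightarrow> real \<Rightarrow> real) \<Rightarrow> (real \<Rightarrow> real \<Rightarrow> real) \<Rightarrow> bool" where
  "forced_burgers_solution \<nu> T F u \<longleftrightarrow>
     (\<forall>t\<in>{0..T}. u t \<in> L2_per) \<and>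
     (\<forall>t\<in>{0..T}. ((\<lambda>s. L2_norm (\<lambda>x. u s x - u t x)) \<longlongrightarrow> 0) (at t within {0..T})) \<and>
     (\<exists>ut ux uxx.
        continuous_on (pde_times \<nu> T \<times> UNIV) (\<lambda>(t, x). ut t x) \<and>
        continuous_on (pde_times \<nu> T \<times> UNIV) (\<lambda>(t, x). ux t x) \<and>
        continuous_on (pde_times \<nu> T \<times> UNIV) (\<lambda>(t, x). uxx t x) \<and>
        (\<forall>t\<in>pde_times \<nu> T. \<forall>x.
           ((\<lambda>s. u s x) has_real_derivative ut t x) (at t within pde_times \<nu> T) \<and>
           (u t has_real_derivative ux t x) (at x) \<and>
           (\<nu> \<noteq> 0 \<longrightarrow> (ux t has_real_derivative uxx t x) (at x)) \<and>
           ut t x = \<nu> * uxx t x - u t x * ux t x + F t x))"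

definition burgers_solution :: "real \<Rightarrow> real \<Rightarrow> (real \<Rightarrow> real \<Rightarrow> real) \<Rightarrow> bool" where
  "burgers_solution \<nu> T u \<longleftrightarrow> forced_burgers_solution \<nu> T (\<lambda>t x. 0) u"

definition forward_solution ::
  "real \<Rightarrow> real \<Rightarrow> nat \<Rightarrow> real \<Rightarrow> (real \<Rightarrow> real \<Rightarrow> real) \<Rightarrow> (real \<Rightarrow> real \<Rightarrow> real) \<Rightarrow> bool" where
  "forward_solution \<nu> \<mu> M T u v \<longleftrightarrow>
     forced_burgers_solution \<nu> T (\<lambda>t x. \<mu> * fourier_proj M (\<lambda>y. u t y - v t y) x) v"

definition backward_solution ::
  "real \<Rightarrow> real \<Rightarrow> nat \<Rightarrow> real \<Rightarrow> (real \<Rightarrow> real \<Rightarrow> real) \<Rightarrow> (real \<Rightarrow> real \<Rightarrow> real) \<Rightarrow> bool" where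
  "backward_solution \<nu> \<mu> M T u w \<longleftrightarrow>
     forced_burgers_solution \<nu> T (\<lambda>t x. - (\<mu> * fourier_proj M (\<lambda>y. u t y - w t y) x)) w"

text \<open>Uniqueness half of the standing well-posedness assumption. Existence is deliberately not
  turned into a hypothesis: for positive viscosity the backward problem is not solvable for all
  terminal data, so such a hypothesis would be contradictory.\<close>

definition unique_forward :: "real \<Rightarrow> real \<Rightarrow> nat \<Rightarrow> real \<Rightarrow> bool" where
  "unique_forward \<nu> \<mu> M T \<longleftrightarrow>
     (\<forall>u v v'. burgers_solution \<nu> T u \<and> forward_solution \<nu> \<mu> M T u v \<and>
        forward_solution \<nu> \<mu> M T u v' \<and> L2_eq (v 0) (v' 0) \<longrightarrow>
        (\<forall>t\<in>{0..T}. L2_eq (v t) (v' t)))"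

definition unique_backward :: "real \<Rightarrow> real \<Rightarrow> nat \<Rightarrow> real \<Rightarrow> bool" where
  "unique_backward \<nu> \<mu> M T \<longleftrightarrow>
     (\<forall>u w w'. burgers_solution \<nu> T u \<and> backward_solution \<nu> \<mu> M T u w \<and>
        backward_solution \<nu> \<mu> M T u w' \<and> L2_eq (w T) (w' T) \<longrightarrow>
        (\<forall>t\<in>{0..T}. L2_eq (w t) (w' t)))"

text \<open>Only the value at time 0 of the backward iterate with index 0 is used; it carries the
  initialization. The iterate \<open>v 0\<close> is irrelevant.\<close>

definition bfn_sequence ::
  "real \<Rightarrow> real \<Rightarrow> nat \<Rightarrow> real \<Rightarrow> (real \<Rightarrow> real \<Rightarrow> real) \<Rightarrow> (real \<Rightarrow> real) \<Rightarrow>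
   (nat \<Rightarrow> real \<Rightarrow> real \<Rightarrow> real) \<Rightarrow> (nat \<Rightarrow> real \<Rightarrow> real \<Rightarrow> real) \<Rightarrow> bool" where
  "bfn_sequence \<nu> \<mu> M T u v0 v w \<longleftrightarrow>
     L2_eq (w 0 0) v0 \<and>
     (\<forall>n\<ge>1. forward_solution \<nu> \<mu> M T u (v n) \<and> L2_eq (v n 0) (w (n - 1) 0) \<and>
             backward_solution \<nu> \<mu> M T u (w n) \<and> L2_eq (w n T) (v n T))"

end

theory Submission
  imports Defs
begin

text \<open>
  The nudging term sees the error \<open>u - v\<close> only through its Fourier modes up to \<open>M\<close>, so an error
  that lives entirely in higher modes is never corrected. Take \<open>u = 0\<close> and let \<open>V\<close> be a nonzero
  solution of the Burgers equation on \<open>[0, T]\<close> whose modes up to \<open>M\<close> vanish at all times. Along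
  \<open>V\<close> the nudging term is zero, whence \<open>V\<close> solves the forward and the backward equation alike, and
  the sequence that starts from \<open>V 0\<close> and never moves is a back-and-forth nudging sequence. By
  uniqueness it is the only one up to null sets (\<open>bfn_sequence_unique\<close>), and its error is the
  constant \<open>L2_norm (V 0) > 0\<close>.

  The quadratic term mixes Fourier modes, so keeping the low modes empty for all times needs a
  reason: it comes from symmetry. The Burgers equation commutes with translations in \<open>x\<close> and with
  \<open>v(x) \<mapsto> - v(- x)\<close>, and therefore admits solutions that are odd and have the short period
  \<open>2 \<pi> / (M + 1)\<close>. The period leaves only modes that are multiples of \<open>M + 1\<close>, and oddness removes
  the mean (\<open>low_fourier_coeff_eq_0\<close>).

  Such a \<open>V\<close> is written down with \<open>k = M + 1\<close>. For \<open>\<nu> > 0\<close> the Cole-Hopf transform of a positive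
  solution of the heat equation gives it in closed form (\<open>viscous_wave\<close>); the same function solves
  the equation run backward, so the ill-posedness of the backward problem does no harm. For
  \<open>\<nu> = 0\<close> the method of characteristics transports a sine profile of amplitude \<open>1 / (2 k T)\<close>, which
  is too flat to form a shock before time \<open>T\<close> (\<open>inviscid_wave\<close>).
\<close>

section \<open>Waves invisible to the low Fourier modes\<close>

lemma integral_over_period_shift:
  fixes F :: "real \<Rightarrow> 'a :: euclidean_space"
  assumes cont: "continuous_on UNIV F" and per: "\<And>x. F (x + L) = F x"
    and h: "0 \<le> h" "h \<le> L"
  shows "integral {0..L} (\<lambda>x. F (x + h)) = integral {0..L} F"
proof -
  have int: "F integrable_on {a..b}" for a b
    by (rule integrable_continuous_real) (rule continuous_on_subset [OF cont], simp)
  have shift: "integral {a..b} (\<lambda>x. F (x + c)) = integral {a + c..b + c} F" for a b c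
    using integral_shift_Icc_real [of a b F c] by (simp add: o_def add.commute)
  have "integral {0..h} F = integral {L..h + L} F"
    using shift [of 0 h L] by (simp add: per)
  then have "integral {0..L} F = integral {L..h + L} F + integral {h..L} F"
    using Henstock_Kurzweil_Integration.integral_combine [OF h int] by simp
  also have "\<dots> = integral {h..L + h} F"
    using Henstock_Kurzweil_Integration.integral_combine [of h L "L + h" F] h int
    by (simp add: add.commute)
  also have "\<dots> = integral {0..L} (\<lambda>x. F (x + h))"
    using shift [of 0 L h] by simp
  finally show ?thesis by simp
qed

lemma fourier_coeff_continuous:
  assumes "continuous_on UNIV g"
  shows "fourier_coeff g j =
    integral {0..2 * pi} (\<lambda>y. complex_of_real (g y) * cis (- (of_int j * y))) / of_real (2 * pi)"
proof -
  have "continuous_on {0..2 * pi} (\<lambda>y. complex_of_real (g y) * cis (- (of_int j * y)))"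
    by (intro continuous_intros continuous_on_subset [OF assms]) auto
  then show ?thesis
    unfolding fourier_coeff_def
    by (simp add: set_lebesgue_integral_eq_integral(2) [OF absolutely_integrable_continuous_real])
qed

lemma periodic_iterate:
  fixes g :: "real \<Rightarrow> 'a"
  assumes "\<And>x. g (x + P) = g x"
  shows "g (x + real n * P) = g x"
proof (induction n)
  case (Suc n)
  then show ?case using assms [of "x + real n * P"] by (simp add: algebra_simps)
qed simp

text \<open>Translation by the short period \<open>P = 2 \<pi> / (M + 1)\<close> leaves \<open>g\<close> unchanged but multiplies its
  \<open>j\<close>-th coefficient by a phase, which is different from 1 unless \<open>M + 1\<close> divides \<open>j\<close>. Among the
  modes up to \<open>M\<close> this spares only the mean, and the mean of an odd function vanishes.\<close>

lemma low_fourier_coeff_eq_0: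
  assumes cont: "continuous_on UNIV g"
    and per: "\<And>x. g (x + 2 * pi / real (Suc M)) = g x"
    and odd: "\<And>x. g (- x) = - g x"
    and j: "\<bar>j\<bar> \<le> int M"
  shows "fourier_coeff g j = 0"
proof -
  define P where "P = 2 * pi / real (Suc M)"
  define F where "F = (\<lambda>y. complex_of_real (g y) * cis (- (of_int j * y)))"
  have P: "P > 0" "P \<le> 2 * pi" "real (Suc M) * P = 2 * pi"
    by (simp_all add: P_def field_simps del: of_nat_Suc)
  have contF: "continuous_on UNIV F"
    unfolding F_def by (intro continuous_intros cont)
  have g2: "g (x + 2 * pi) = g x" for x
    using periodic_iterate [of g P x "Suc M"] per P(3) by (simp add: P_def)
  have cis2: "cis (- (of_int j * (x + 2 * pi))) = cis (- (of_int j * x))" for x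
  proof -
    have "cis (- (of_int j * (x + 2 * pi))) = cis (- (of_int j * x)) * cis (2 * pi * of_int (- j))"
      by (simp only: cis_mult) (simp add: algebra_simps)
    also have "cis (2 * pi * of_int (- j)) = 1"
      by (rule cis_multiple_2pi) simp
    finally show ?thesis by simp
  qed
  have perF: "F (x + 2 * pi) = F x" for x
    by (simp only: F_def g2 cis2)
  have "integral {0..2 * pi} F = 0"
  proof (cases "j = 0")
    case True
    \<comment> \<open>The mean is the only low mode that periodicity does not kill; oddness does.\<close>
    have F: "F (- x) = - F x" for x
      using True by (simp add: F_def odd)
    have "integral {0..2 * pi} F = integral {- (2 * pi)..- 0} (\<lambda>x. F (- x))"
      by (rule Henstock_Kurzweil_Integration.integral_reflect_real [symmetric])
    also have "\<dots> = - integral {- (2 * pi)..0} F"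
      by (simp add: F)
    also have "integral {- (2 * pi)..0} F = integral {- (2 * pi)..0} (\<lambda>x. F (x + 2 * pi))"
      by (simp add: perF)
    also have "\<dots> = integral {0..2 * pi} F"
      using integral_shift_Icc_real [of "- (2 * pi)" 0 F "2 * pi"]
      by (simp add: o_def add.commute)
    finally show ?thesis by (simp add: eq_neg_iff_add_eq_0 flip: mult_2)
  next
    case False
    \<comment> \<open>A shift by the short period multiplies the coefficient by a root of unity other than 1.\<close>
    have Fshift: "F (x + P) = cis (- (of_int j * P)) * F x" for x
    proof -
      have "cis (- (of_int j * (x + P))) = cis (- (of_int j * P)) * cis (- (of_int j * x))"
        by (simp only: cis_mult) (simp add: algebra_simps)
      moreover have "g (x + P) = g x" using per by (simp add: P_def)
      ultimately show ?thesis by (simp only: F_def) (simp add: mult_ac)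
    qed
    have "integral {0..2 * pi} F = integral {0..2 * pi} (\<lambda>x. F (x + P))"
      using integral_over_period_shift [OF contF perF, of P] P by simp
    also have "\<dots> = cis (- (of_int j * P)) * integral {0..2 * pi} F"
      by (simp add: Fshift)
    finally have "integral {0..2 * pi} F = 0 \<or> cis (- (of_int j * P)) = 1"
      by (metis mult_cancel_right1)
    moreover have "cis (- (of_int j * P)) \<noteq> 1"
    proof
      assume "cis (- (of_int j * P)) = 1"
      then have "cos (of_int j * P) = 1"
        by (metis cis.sel(1) cos_minus one_complex.sel(1))
      then obtain n :: int where n: "of_int j * P = of_int n * 2 * pi"
        unfolding cos_one_2pi_int by blast
      have "of_int j * (2 * pi) = real (Suc M) * (of_int j * P)"
        by (metis P(3) mult.left_commute)
      then have "of_int j * (2 * pi) = (of_int n * real (Suc M)) * (2 * pi)"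
        unfolding n by (simp add: mult_ac del: of_nat_Suc)
      then have "(of_int j :: real) = of_int n * real (Suc M)"
        by simp
      then have "(of_int j :: real) = of_int (n * int (Suc M))"
        by simp
      then have "j = n * int (Suc M)"
        by (simp only: of_int_eq_iff)
      then have "int (Suc M) dvd j" by simp
      then have "int (Suc M) \<le> \<bar>j\<bar>"
        using dvd_imp_le_int [OF False, of "int (Suc M)"] by (simp del: of_nat_Suc)
      then show False using j by simp
    qed
    ultimately show ?thesis by blast
  qed
  then show ?thesis
    by (simp add: fourier_coeff_continuous [OF cont] F_def)
qed

lemma fourier_proj_eq_0:
  assumes "continuous_on UNIV g" "\<And>x. g (x + 2 * pi / real (Suc M)) = g x"
    and "\<And>x. g (- x) = - g x"
  shows "fourier_proj M g x = 0"
  unfolding fourier_proj_def using low_fourier_coeff_eq_0 [OF assms] by (simp add: abs_le_iff)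

section \<open>Classical solutions\<close>

lemma continuous_on_slice:
  fixes V :: "'a :: topological_space \<Rightarrow> 'b :: topological_space \<Rightarrow> 'c :: topological_space"
  assumes "continuous_on (A \<times> UNIV) (\<lambda>(t, x). V t x)" and "t \<in> A"
  shows "continuous_on UNIV (V t)"
proof -
  have "continuous_on UNIV ((\<lambda>(t, x). V t x) \<circ> (\<lambda>x. (t, x)))"
    by (rule continuous_on_compose)
       (use assms(2) in \<open>auto intro!: continuous_intros continuous_on_subset [OF assms(1)]\<close>)
  then show ?thesis by (simp add: o_def)
qed

lemma L2_norm_continuous:
  assumes "continuous_on UNIV g"
  shows "L2_norm g = sqrt (integral {0..2 * pi} (\<lambda>x. (g x)\<^sup>2))"
proof -
  have "continuous_on {0..2 * pi} (\<lambda>x. (g x)\<^sup>2)"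
    by (intro continuous_intros continuous_on_subset [OF assms]) auto
  then show ?thesis
    unfolding L2_norm_def
    by (simp add: set_lebesgue_integral_eq_integral(2) [OF absolutely_integrable_continuous_real])
qed

lemma L2_norm_pos:
  assumes cont: "continuous_on UNIV g" and x: "x \<in> {0..2 * pi}" "g x \<noteq> 0"
  shows "L2_norm g > 0"
proof -
  have c: "continuous_on {0..2 * pi} (\<lambda>x. (g x)\<^sup>2)"
    by (intro continuous_intros continuous_on_subset [OF cont]) auto
  have "integral {0..2 * pi} (\<lambda>x. (g x)\<^sup>2) \<noteq> 0"
    using integral_eq_0_iff [OF c] x by auto
  moreover have "integral {0..2 * pi} (\<lambda>x. (g x)\<^sup>2) \<ge> 0"
    by (rule Henstock_Kurzweil_Integration.integral_nonneg [OF integrable_continuous_real [OF c]]) simp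
  ultimately show ?thesis
    by (simp add: L2_norm_continuous [OF cont])
qed

lemma L2_per_continuous:
  assumes "continuous_on UNIV g" "\<And>x. g (x + 2 * pi) = g x"
  shows "g \<in> L2_per"
proof -
  have "g \<in> borel_measurable borel"
    by (rule borel_measurable_continuous_onI [OF assms(1)])
  then have "g \<in> borel_measurable lebesgue"
    by (simp add: measurable_completion)
  moreover have "set_integrable lebesgue {0..2 * pi} (\<lambda>x. (g x)\<^sup>2)"
    by (intro absolutely_integrable_continuous_real continuous_intros
        continuous_on_subset [OF assms(1)]) auto
  ultimately show ?thesis
    using assms(2) by (simp add: L2_per_def)
qed

lemma L2_norm_le_sup:
  assumes cont: "continuous_on UNIV g" and bound: "\<And>x. x \<in> {0..2 * pi} \<Longrightarrow> \<bar>g x\<bar> \<le> e"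
    and e: "e \<ge> 0"
  shows "L2_norm g \<le> e * sqrt (2 * pi)"
proof -
  have "integral {0..2 * pi} (\<lambda>x. (g x)\<^sup>2) \<le> integral {0..2 * pi} (\<lambda>x. e\<^sup>2)"
  proof (rule integral_le)
    show "(\<lambda>x. (g x)\<^sup>2) integrable_on {0..2 * pi}"
      by (intro integrable_continuous_real continuous_intros continuous_on_subset [OF cont]) auto
    show "(g x)\<^sup>2 \<le> e\<^sup>2" if "x \<in> {0..2 * pi}" for x
      using bound [OF that] e by (simp add: abs_le_square_iff [symmetric])
  qed auto
  then have "L2_norm g \<le> sqrt (2 * pi * e\<^sup>2)"
    by (simp add: L2_norm_continuous [OF cont])
  also have "\<dots> = e * sqrt (2 * pi)"
    using e by (simp add: real_sqrt_mult)
  finally show ?thesis .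
qed

text \<open>Joint continuity makes the slices \<open>V s\<close> converge uniformly on one compact period.\<close>

lemma L2_norm_tendsto_0:
  fixes V :: "real \<Rightarrow> real \<Rightarrow> real"
  assumes cont: "continuous_on (A \<times> UNIV) (\<lambda>(t, x). V t x)" and A: "compact A" and t: "t \<in> A"
  shows "((\<lambda>s. L2_norm (\<lambda>x. V s x - V t x)) \<longlongrightarrow> 0) (at t within A)"
proof -
  note slice = continuous_on_slice [OF cont]
  have "uniformly_continuous_on (A \<times> {0..2 * pi}) (\<lambda>(t, x). V t x)"
    by (rule compact_uniformly_continuous)
       (auto intro: compact_Times A continuous_on_subset [OF cont])
  then have unif: "\<exists>d>0. \<forall>s\<in>A. \<forall>x\<in>{0..2 * pi}. dist s t < d \<longrightarrow> \<bar>V s x - V t x\<bar> < e" if "e > 0" for e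
  proof -
    obtain d where "d > 0" and d: "\<And>p q. p \<in> A \<times> {0..2 * pi} \<Longrightarrow> q \<in> A \<times> {0..2 * pi} \<Longrightarrow>
        dist q p < d \<Longrightarrow> dist (case q of (t, x) \<Rightarrow> V t x) (case p of (t, x) \<Rightarrow> V t x) < e"
      using \<open>uniformly_continuous_on _ _\<close> \<open>e > 0\<close> unfolding uniformly_continuous_on_def by metis
    have "\<bar>V s x - V t x\<bar> < e" if "s \<in> A" "x \<in> {0..2 * pi}" "dist s t < d" for s x
      using d [of "(t, x)" "(s, x)"] that t by (simp add: dist_Pair_Pair dist_real_def)
    with \<open>d > 0\<close> show ?thesis by blast
  qed
  show ?thesis
  proof (rule tendstoI)
    fix e :: real assume "e > 0"
    define e' where "e' = e / (2 * sqrt (2 * pi))"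
    have e': "e' > 0" "e' * sqrt (2 * pi) < e"
      using \<open>e > 0\<close> by (auto simp: e'_def field_simps)
    obtain d where d: "d > 0" "\<And>s x. s \<in> A \<Longrightarrow> x \<in> {0..2 * pi} \<Longrightarrow> dist s t < d \<Longrightarrow> \<bar>V s x - V t x\<bar> < e'"
      using unif [OF e'(1)] by blast
    have "dist (L2_norm (\<lambda>x. V s x - V t x)) 0 < e" if s: "s \<in> A" "dist s t < d" for s
    proof -
      have c: "continuous_on UNIV (\<lambda>x. V s x - V t x)"
        by (intro continuous_intros slice s t)
      have "L2_norm (\<lambda>x. V s x - V t x) \<le> e' * sqrt (2 * pi)"
        by (rule L2_norm_le_sup [OF c]) (use d(2) s e'(1) in \<open>auto intro: less_imp_le\<close>)
      moreover have "L2_norm (\<lambda>x. V s x - V t x) \<ge> 0"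
        by (simp add: L2_norm_continuous [OF c] Henstock_Kurzweil_Integration.integral_nonneg
            integrable_continuous_real continuous_intros continuous_on_subset [OF c])
      ultimately show ?thesis using e'(2) by simp
    qed
    then show "\<forall>\<^sub>F s in at t within A. dist (L2_norm (\<lambda>x. V s x - V t x)) 0 < e"
      unfolding eventually_at using d(1) by blast
  qed
qed

text \<open>A solution that is regular up to both end points solves the equation in the required sense for
  zero and for positive viscosity, where the equation is imposed at different sets of times. This
  leaves only pointwise differential identities to be checked for the explicit waves.\<close>

lemma classical_burgers_solution:
  assumes cont: "continuous_on ({0..T} \<times> UNIV) (\<lambda>(t, x). V t x)"
    and per: "\<And>t x. t \<in> {0..T} \<Longrightarrow> V t (x + 2 * pi) = V t x"
    and cont_t: "continuous_on ({0..T} \<times> UNIV) (\<lambda>(t, x). Vt t x)"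
    and cont_x: "continuous_on ({0..T} \<times> UNIV) (\<lambda>(t, x). Vx t x)"
    and cont_xx: "continuous_on ({0..T} \<times> UNIV) (\<lambda>(t, x). Vxx t x)"
    and deriv_t: "\<And>t x. t \<in> {0..T} \<Longrightarrow> ((\<lambda>s. V s x) has_real_derivative Vt t x) (at t within {0..T})"
    and deriv_x: "\<And>t x. t \<in> {0..T} \<Longrightarrow> (V t has_real_derivative Vx t x) (at x)"
    and deriv_xx: "\<And>t x. \<nu> \<noteq> 0 \<Longrightarrow> t \<in> {0..T} \<Longrightarrow> (Vx t has_real_derivative Vxx t x) (at x)"
    and eq: "\<And>t x. t \<in> {0..T} \<Longrightarrow> Vt t x = \<nu> * Vxx t x - V t x * Vx t x"
  shows "burgers_solution \<nu> T V"
proof -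
  have sub: "pde_times \<nu> T \<subseteq> {0..T}"
    by (auto simp: pde_times_def)
  note slice = continuous_on_slice [OF cont]
  have "pde_times \<nu> T \<times> UNIV \<subseteq> {0..T} \<times> (UNIV :: real set)"
    using sub by auto
  note restrict = continuous_on_subset [OF _ this]
  show ?thesis
    unfolding burgers_solution_def forced_burgers_solution_def
  proof (intro conjI ballI)
    show "V t \<in> L2_per" if "t \<in> {0..T}" for t
      using that by (intro L2_per_continuous slice per)
    show "((\<lambda>s. L2_norm (\<lambda>x. V s x - V t x)) \<longlongrightarrow> 0) (at t within {0..T})"
      if "t \<in> {0..T}" for t
      using that by (intro L2_norm_tendsto_0 [OF cont]) auto
  qed (rule exI [of _ Vt], rule exI [of _ Vx], rule exI [of _ Vxx], intro conjI ballI allI impI,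
      rule restrict [OF cont_t], rule restrict [OF cont_x], rule restrict [OF cont_xx],
      rule DERIV_subset [OF deriv_t], erule subsetD [OF sub], rule sub,
      rule deriv_x, erule subsetD [OF sub], rule deriv_xx, assumption, erule subsetD [OF sub],
      simp only: add_0_right, rule eq, erule subsetD [OF sub])
qed

lemma burgers_solution_0: "burgers_solution \<nu> T (\<lambda>t x. 0)"
  by (rule classical_burgers_solution [where Vt = "\<lambda>t x. 0" and Vx = "\<lambda>t x. 0" and Vxx = "\<lambda>t x. 0"])
     auto

lemma forced_burgers_solution_cong:
  assumes "\<And>t x. t \<in> {0..T} \<Longrightarrow> F t x = G t x"
  shows "forced_burgers_solution \<nu> T F u \<longleftrightarrow> forced_burgers_solution \<nu> T G u"
proof -
  have "t \<in> pde_times \<nu> T \<Longrightarrow> F t x = G t x" for t x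
    using assms by (auto simp: pde_times_def split: if_splits)
  then show ?thesis
    unfolding forced_burgers_solution_def by (simp cong: ball_cong)
qed

section \<open>A viscous wave\<close>

text \<open>The function \<open>\<phi> t x = 2 + e t * cos (k * x)\<close> solves the heat equation \<open>\<phi>\<^sub>t = \<nu> \<phi>\<^sub>x\<^sub>x\<close>, and \<open>V\<close> is its
  Cole-Hopf transform \<open>- 2 \<nu> \<phi>\<^sub>x / \<phi>\<close>. The constant 2 keeps \<open>\<phi>\<close> positive at all times \<open>t \<ge> 0\<close>,
  where \<open>e t \<le> 1\<close>.\<close>

lemma viscous_wave:
  fixes \<nu> T :: real and k :: nat
  assumes nu: "\<nu> > 0" and k: "k > 0"
  defines "e \<equiv> \<lambda>t. exp (- (\<nu> * (real k)\<^sup>2 * t))"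
  defines "V \<equiv> \<lambda>t x. 2 * \<nu> * real k * e t * sin (real k * x) / (2 + e t * cos (real k * x))"
  shows "continuous_on ({0..T} \<times> UNIV) (\<lambda>(t, x). V t x)" (is ?cont)
    and "burgers_solution \<nu> T V"
proof -
  define r where "r = real k"
  define s where "s = (\<lambda>x. sin (r * x))"
  define c where "c = (\<lambda>x. cos (r * x))"
  define Q where "Q = (\<lambda>t x. 2 + e t * c x)"
  have V: "V t x = 2 * \<nu> * r * e t * s x / Q t x" for t x
    by (simp add: V_def r_def s_def c_def Q_def)
  have Q: "Q t x > 0" if "t \<ge> 0" for t x
  proof -
    have "\<bar>e t * c x\<bar> \<le> 1 * 1"
      unfolding abs_mult using that nu
      by (intro mult_mono) (auto simp: e_def c_def)
    then show ?thesis by (simp add: Q_def abs_le_iff)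
  qed
  then have Q0: "Q t x \<noteq> 0" if "t \<ge> 0" for t x
    using that by (metis less_irrefl)
  have sc: "(s x)\<^sup>2 + (c x)\<^sup>2 = 1" for x
    by (simp add: s_def c_def)
  have contQ: "continuous_on X (\<lambda>(t, x). Q t x)" for X
    by (auto simp: Q_def e_def c_def split_beta intro!: continuous_intros)
  have conte: "continuous_on X (\<lambda>p :: real \<times> real. e (fst p))" for X
    by (auto simp: e_def intro!: continuous_intros)
  have conts: "continuous_on X (\<lambda>p :: real \<times> real. s (snd p))" for X
    by (auto simp: s_def intro!: continuous_intros)
  have contc: "continuous_on X (\<lambda>p :: real \<times> real. c (snd p))" for X
    by (auto simp: c_def intro!: continuous_intros)
  note conts = contQ [unfolded split_beta] conte conts contc
  show cont: ?cont
    by (auto simp: V split_beta Q0 intro!: continuous_intros conts)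
  have de: "(e has_real_derivative - (\<nu> * r\<^sup>2) * e t) (at t within A)" for t A
    by (auto simp: e_def r_def intro!: derivative_eq_intros)
  have ds: "(s has_real_derivative r * c x) (at x within A)" for x A
    by (auto simp: s_def c_def intro!: derivative_eq_intros)
  have dc: "(c has_real_derivative - (r * s x)) (at x within A)" for x A
    by (auto simp: s_def c_def intro!: derivative_eq_intros)
  \<comment> \<open>The partial derivatives of \<open>V\<close>, after reduction by \<open>sc\<close>.\<close>
  define Vt where "Vt = (\<lambda>t x. - 4 * \<nu>\<^sup>2 * r ^ 3 * e t * s x / (Q t x)\<^sup>2)"
  define Vx where "Vx = (\<lambda>t x. 2 * \<nu> * r\<^sup>2 * e t * (2 * c x + e t) / (Q t x)\<^sup>2)"
  define Vxx where "Vxx = (\<lambda>t x. 4 * \<nu> * r ^ 3 * e t * s x * (- 2 + e t * c x + (e t)\<^sup>2) / (Q t x) ^ 3)"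
  show "burgers_solution \<nu> T V"
  proof (rule classical_burgers_solution [OF cont, where Vt = Vt and Vx = Vx and Vxx = Vxx])
    fix t x :: real assume "t \<in> {0..T}"
    then have t: "t \<ge> 0" by simp
    note q = Q0 [OF t, of x]
    have per: "s (x + 2 * pi) = s x" "c (x + 2 * pi) = c x"
      using sin.plus_of_nat [of "real k * x" k] cos.plus_of_nat [of "real k * x" k]
      by (simp_all add: s_def c_def r_def algebra_simps)
    then show "V t (x + 2 * pi) = V t x"
      by (simp add: V Q_def)
    show "((\<lambda>s. V s x) has_real_derivative Vt t x) (at t within {0..T})"
      unfolding V Q_def
      apply (rule derivative_eq_intros de refl)+
      using q apply (simp add: Q_def)
      using q by (simp add: Vt_def Q_def divide_simps power2_eq_square power3_eq_cube) (simp add: algebra_simps)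
    have "(V t has_real_derivative 2 * \<nu> * r\<^sup>2 * e t * (2 * c x + e t * ((s x)\<^sup>2 + (c x)\<^sup>2)) / (Q t x)\<^sup>2) (at x)"
      unfolding V [abs_def] Q_def
      apply (rule derivative_eq_intros ds dc refl)+
      using q apply (simp add: Q_def)
      using q by (simp add: Q_def divide_simps power2_eq_square power3_eq_cube) (simp add: algebra_simps)
    then show "(V t has_real_derivative Vx t x) (at x)"
      by (simp only: sc Vx_def) simp
    show "(Vx t has_real_derivative Vxx t x) (at x)"
      unfolding Vx_def Q_def
      apply (rule derivative_eq_intros ds dc refl)+
      using q apply (simp add: Q_def)
      using q apply (simp add: Vxx_def Q_def divide_simps)
      by (simp add: power2_eq_square power3_eq_cube power4_eq_xxxx algebra_simps)
    have "\<nu> * Vxx t x - V t x * Vx t x =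
      4 * \<nu>\<^sup>2 * r ^ 3 * e t * s x * (- Q t x) / (Q t x) ^ 3"
      using q apply (simp add: Vxx_def V Vx_def divide_simps)
      by (simp add: Q_def power2_eq_square power3_eq_cube algebra_simps)
    also have "\<dots> = Vt t x"
      using q by (simp add: Vt_def power2_eq_square power3_eq_cube)
    finally show "Vt t x = \<nu> * Vxx t x - V t x * Vx t x" ..
  qed (auto simp: Vt_def Vx_def Vxx_def split_beta Q0 intro!: continuous_intros conts)
qed

section \<open>An inviscid wave\<close>

text \<open>The characteristic of the inviscid equation that passes through \<open>x\<close> at time \<open>t\<close> starts at the
  foot \<open>y\<close> with \<open>y + t * f y = x\<close>. As long as \<open>t * L \<le> 1 / 2\<close>, the map \<open>y \<mapsto> x - t * f y\<close> is a
  contraction, and the foot is its fixed point.\<close>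

lemma characteristic_foot_exists1:
  fixes f :: "real \<Rightarrow> real"
  assumes lip: "\<And>y z. \<bar>f y - f z\<bar> \<le> L * \<bar>y - z\<bar>" and t: "0 \<le> t" "t * L \<le> 1 / 2"
  shows "\<exists>!y. y + t * f y = x"
proof -
  have "\<exists>!y. x - t * f y = y"
  proof (rule banach_fix_type)
    show "\<forall>y z. dist (x - t * f y) (x - t * f z) \<le> 1 / 2 * dist y z"
    proof (intro allI)
      fix y z
      have "dist (x - t * f y) (x - t * f z) = \<bar>t * (f z - f y)\<bar>"
        by (simp add: dist_real_def algebra_simps)
      also have "\<dots> = t * \<bar>f y - f z\<bar>"
        using t(1) by (simp add: abs_mult abs_minus_commute)
      also have "\<dots> \<le> (t * L) * \<bar>y - z\<bar>"
        using mult_left_mono [OF lip t(1)] by (simp add: mult_ac)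
      also have "\<dots> \<le> 1 / 2 * dist y z"
        unfolding dist_real_def using t(2) by (rule mult_right_mono) simp
      finally show "dist (x - t * f y) (x - t * f z) \<le> 1 / 2 * dist y z" .
    qed
  qed simp_all
  moreover have "x - t * f y = y \<longleftrightarrow> y + t * f y = x" for y
    by auto
  ultimately show ?thesis by simp
qed

text \<open>The setting of the method of characteristics for an initial profile \<open>f\<close>, where \<open>Y t x\<close> is the foot
  of the characteristic through \<open>x\<close> at time \<open>t\<close>. The bound on \<open>T * L\<close> keeps the stretching factor
  \<open>1 + t * f' y\<close> of the characteristic flow away from 0, which is what excludes a shock.\<close>

locale characteristics =
  fixes f f' :: "real \<Rightarrow> real" and L T :: real and Y :: "real \<Rightarrow> real \<Rightarrow> real"
  assumes deriv: "\<And>y. (f has_real_derivative f' y) (at y)"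
    and cont_f': "continuous_on UNIV f'"
    and bound: "\<And>y. \<bar>f' y\<bar> \<le> L"
    and small: "T * L \<le> 1 / 2"
    and foot: "\<And>t x. t \<in> {0..T} \<Longrightarrow> Y t x + t * f (Y t x) = x"
begin

lemma L_nonneg: "L \<ge> 0"
  using bound [of 0] by linarith

lemma time_small: "t * L \<le> 1 / 2" if "t \<in> {0..T}"
  using that small mult_right_mono [of t T L] L_nonneg by simp

lemma stretch_ge: "1 + t * q \<ge> 1 / 2" if "t \<in> {0..T}" "\<bar>q\<bar> \<le> L" for t q
proof -
  have "\<bar>t * q\<bar> \<le> t * L"
    using that by (simp add: abs_mult mult_left_mono)
  then show ?thesis using time_small [OF that(1)] by linarith
qed

text \<open>The slope \<open>g\<close> of the chords of \<open>f\<close> through \<open>y\<close> turns the implicit equation for the foot into a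
  linear one: a difference of two feet can be solved for exactly, with \<open>1 + t * g z\<close> as divisor. The
  mean value theorem bounds \<open>g\<close>, so this divisor is at least \<open>1 / 2\<close>. Lipschitz continuity and both
  partial derivatives of the foot all follow from this one device.\<close>

lemma chord:
  obtains g where "\<And>z. f z - f y = g z * (z - y)" "isCont g y" "g y = f' y" "\<And>z. \<bar>g z\<bar> \<le> L"
proof -
  obtain g where g: "\<And>z. f z - f y = g z * (z - y)" "isCont g y" "g y = f' y"
    using deriv [of y] unfolding CARAT_DERIV by metis
  have "\<bar>g z\<bar> \<le> L" for z
  proof (cases "z = y")
    case False
    have "norm (f z - f y) \<le> L * norm (z - y)"
      by (rule field_differentiable_bound [of UNIV f f']) (use deriv bound in auto)
    then show ?thesis
      using g(1) [of z] False by (simp add: abs_mult)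
  qed (use g(3) bound in simp)
  with g show ?thesis by (rule that)
qed

lemma foot_lipschitz:
  assumes s: "s \<in> {0..T}" and t: "t \<in> {0..T}"
  shows "\<bar>Y s x' - Y t x\<bar> \<le> 2 * (\<bar>x' - x\<bar> + \<bar>s - t\<bar> * \<bar>f (Y t x)\<bar>)"
proof -
  obtain g where g: "\<And>z. f z - f (Y t x) = g z * (z - Y t x)" "\<And>z. \<bar>g z\<bar> \<le> L"
    by (rule chord [of "Y t x"]) blast
  define q where "q = g (Y s x')"
  have fq: "f (Y s x') = f (Y t x) + q * (Y s x' - Y t x)"
    using g(1) [of "Y s x'"] by (simp add: q_def)
  have "(1 + s * q) * (Y s x' - Y t x) = (x' - x) - (s - t) * f (Y t x)"
    using foot [OF s, of x'] foot [OF t, of x] fq by (simp add: algebra_simps)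
  then have "(1 + s * q) * \<bar>Y s x' - Y t x\<bar> = \<bar>(x' - x) - (s - t) * f (Y t x)\<bar>"
    using stretch_ge [OF s, of q] g(2) by (metis abs_mult abs_of_nonneg half_gt_zero_iff less_eq_real_def less_le_trans q_def zero_less_one)
  also have "\<dots> \<le> \<bar>x' - x\<bar> + \<bar>s - t\<bar> * \<bar>f (Y t x)\<bar>"
    by (metis abs_mult abs_triangle_ineq4)
  finally have "(1 + s * q) * \<bar>Y s x' - Y t x\<bar> \<le> \<bar>x' - x\<bar> + \<bar>s - t\<bar> * \<bar>f (Y t x)\<bar>" .
  moreover have "1 / 2 * \<bar>Y s x' - Y t x\<bar> \<le> (1 + s * q) * \<bar>Y s x' - Y t x\<bar>"
    using stretch_ge [OF s, of q] g(2) by (intro mult_right_mono) (auto simp: q_def)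
  ultimately have "1 / 2 * \<bar>Y s x' - Y t x\<bar> \<le> \<bar>x' - x\<bar> + \<bar>s - t\<bar> * \<bar>f (Y t x)\<bar>"
    by (rule order_trans [rotated])
  then show ?thesis by simp
qed

lemma foot_continuous: "continuous_on ({0..T} \<times> UNIV) (\<lambda>(t, x). Y t x)"
  unfolding continuous_on_def split_beta
proof
  fix p :: "real \<times> real" assume p: "p \<in> {0..T} \<times> UNIV"
  have "((\<lambda>r. 2 * (\<bar>snd r - snd p\<bar> + \<bar>fst r - fst p\<bar> * \<bar>f (Y (fst p) (snd p))\<bar>)) \<longlongrightarrow>
      2 * (\<bar>snd p - snd p\<bar> + \<bar>fst p - fst p\<bar> * \<bar>f (Y (fst p) (snd p))\<bar>)) (at p within {0..T} \<times> UNIV)"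
    by (intro tendsto_intros)
  then have "((\<lambda>r. 2 * (\<bar>snd r - snd p\<bar> + \<bar>fst r - fst p\<bar> * \<bar>f (Y (fst p) (snd p))\<bar>)) \<longlongrightarrow> 0)
      (at p within {0..T} \<times> UNIV)"
    by simp
  then have "((\<lambda>r. Y (fst r) (snd r) - Y (fst p) (snd p)) \<longlongrightarrow> 0) (at p within {0..T} \<times> UNIV)"
  proof (rule Lim_null_comparison [rotated])
    show "\<forall>\<^sub>F r in at p within {0..T} \<times> UNIV. norm (Y (fst r) (snd r) - Y (fst p) (snd p))
        \<le> 2 * (\<bar>snd r - snd p\<bar> + \<bar>fst r - fst p\<bar> * \<bar>f (Y (fst p) (snd p))\<bar>)"
      unfolding eventually_at_filter
      by (rule always_eventually) (use p foot_lipschitz in auto)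
  qed
  then show "((\<lambda>r. Y (fst r) (snd r)) \<longlongrightarrow> Y (fst p) (snd p)) (at p within {0..T} \<times> UNIV)"
    by (simp add: LIM_zero_iff)
qed

lemma foot_deriv_space:
  assumes t: "t \<in> {0..T}"
  shows "(Y t has_real_derivative 1 / (1 + t * f' (Y t x))) (at x)"
proof -
  obtain g where g: "\<And>z. f z - f (Y t x) = g z * (z - Y t x)" "isCont g (Y t x)"
      "g (Y t x) = f' (Y t x)" "\<And>z. \<bar>g z\<bar> \<le> L"
    by (rule chord [of "Y t x"]) blast
  have pos: "1 + t * g z > 0" for z
    using stretch_ge [OF t g(4), of z] by linarith
  have "continuous_on UNIV (Y t)"
    by (rule continuous_on_slice [OF foot_continuous t])
  then have "isCont (Y t) x"
    by (simp add: continuous_on_eq_continuous_at)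
  then have "isCont (\<lambda>z. g (Y t z)) x"
    using g(2) by (rule isCont_o2)
  then have "isCont (\<lambda>z. 1 / (1 + t * g (Y t z))) x"
    using pos [of "Y t x"] by (intro continuous_intros) auto
  moreover have "Y t z - Y t x = 1 / (1 + t * g (Y t z)) * (z - x)" for z
  proof -
    have "(1 + t * g (Y t z)) * (Y t z - Y t x) = (Y t z - Y t x) + t * (f (Y t z) - f (Y t x))"
      by (simp add: g(1) algebra_simps)
    also have "\<dots> = z - x"
      using foot [OF t, of z] foot [OF t, of x] by (simp add: algebra_simps)
    finally show ?thesis
      using pos [of "Y t z"] by (simp add: field_simps)
  qed
  ultimately show ?thesis
    unfolding CARAT_DERIV using g(3) by (intro exI [of _ "\<lambda>z. 1 / (1 + t * g (Y t z))"]) auto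
qed

lemma foot_deriv_time:
  assumes t: "t \<in> {0..T}"
  shows "((\<lambda>s. Y s x) has_real_derivative - f (Y t x) / (1 + t * f' (Y t x))) (at t within {0..T})"
proof -
  obtain g where g: "\<And>z. f z - f (Y t x) = g z * (z - Y t x)" "isCont g (Y t x)"
      "g (Y t x) = f' (Y t x)" "\<And>z. \<bar>g z\<bar> \<le> L"
    by (rule chord [of "Y t x"]) blast
  have pos: "1 + s * g z > 0" if "s \<in> {0..T}" for s z
    using stretch_ge [OF that g(4), of z] by linarith
  have "continuous_on {0..T} (\<lambda>s. Y s x)"
  proof -
    have "continuous_on {0..T} ((\<lambda>(t, x). Y t x) \<circ> (\<lambda>s. (s, x)))"
      by (rule continuous_on_compose)
         (auto intro!: continuous_intros continuous_on_subset [OF foot_continuous])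
    then show ?thesis by (simp add: o_def)
  qed
  then have "((\<lambda>s. Y s x) \<longlongrightarrow> Y t x) (at t within {0..T})"
    using t by (simp add: continuous_on_def)
  then have "((\<lambda>s. g (Y s x)) \<longlongrightarrow> g (Y t x)) (at t within {0..T})"
    by (rule isCont_tendsto_compose [OF g(2)])
  then have lim: "((\<lambda>s. - f (Y t x) / (1 + s * g (Y s x))) \<longlongrightarrow> - f (Y t x) / (1 + t * g (Y t x)))
      (at t within {0..T})"
    using pos [OF t, of "Y t x"] by (intro tendsto_intros) auto
  have "(Y s x - Y t x) / (s - t) = - f (Y t x) / (1 + s * g (Y s x))" if s: "s \<in> {0..T}" "s \<noteq> t" for s
  proof -
    have "(1 + s * g (Y s x)) * (Y s x - Y t x) = (Y s x - Y t x) + s * (f (Y s x) - f (Y t x))"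
      by (simp add: g(1) algebra_simps)
    also have "\<dots> = - f (Y t x) * (s - t)"
      using foot [OF s(1), of x] foot [OF t, of x] by (simp add: algebra_simps)
    finally show ?thesis
      using pos [OF s(1), of "Y s x"] s(2) by (simp add: field_simps)
  qed
  then have "\<forall>\<^sub>F s in at t within {0..T}. - f (Y t x) / (1 + s * g (Y s x)) = (Y s x - Y t x) / (s - t)"
    by (auto simp: eventually_at_filter)
  then show ?thesis
    using lim g(3) unfolding has_field_derivative_iff by (simp add: Lim_transform_eventually)
qed

text \<open>The solution is constant along characteristics, so its value at \<open>(t, x)\<close> is that of the profile at
  the foot. The equation holds because \<open>Y\<close> itself satisfies \<open>Y\<^sub>t = - f(Y) Y\<^sub>x\<close>.\<close>

lemma inviscid_wave:
  assumes per: "\<And>t x. t \<in> {0..T} \<Longrightarrow> f (Y t (x + 2 * pi)) = f (Y t x)"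
  shows "continuous_on ({0..T} \<times> UNIV) (\<lambda>(t, x). f (Y t x))"
    and "burgers_solution 0 T (\<lambda>t x. f (Y t x))"
proof -
  have contf: "continuous_on UNIV f"
    by (intro continuous_at_imp_continuous_on ballI DERIV_isCont [OF deriv])
  note contY = foot_continuous [unfolded split_beta]
  note cf = continuous_on_compose2 [OF contf contY subset_UNIV]
  note cf' = continuous_on_compose2 [OF cont_f' contY subset_UNIV]
  show cont: "continuous_on ({0..T} \<times> UNIV) (\<lambda>(t, x). f (Y t x))"
    using cf by (simp add: split_beta)
  have pos: "1 + t * f' y > 0" if "t \<in> {0..T}" for t y
    using stretch_ge [OF that bound, of y] by linarith
  then have ne: "1 + t * f' y \<noteq> 0" if "t \<in> {0..T}" for t y
    using that by (metis less_irrefl)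
  define Vt where "Vt = (\<lambda>t x. f' (Y t x) * (- f (Y t x) / (1 + t * f' (Y t x))))"
  define Vx where "Vx = (\<lambda>t x. f' (Y t x) * (1 / (1 + t * f' (Y t x))))"
  show "burgers_solution 0 T (\<lambda>t x. f (Y t x))"
  proof (rule classical_burgers_solution [OF cont, where Vt = Vt and Vx = Vx and Vxx = "\<lambda>t x. 0"])
    show "continuous_on ({0..T} \<times> UNIV) (\<lambda>(t, x). Vt t x)"
      unfolding Vt_def split_beta by (intro continuous_intros cf cf') (use ne in force)
    show "continuous_on ({0..T} \<times> UNIV) (\<lambda>(t, x). Vx t x)"
      unfolding Vx_def split_beta by (intro continuous_intros cf cf') (use ne in force)
    fix t x assume t: "t \<in> {0..T}"
    show "((\<lambda>s. f (Y s x)) has_real_derivative Vt t x) (at t within {0..T})"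
      unfolding Vt_def by (rule DERIV_chain2 [OF deriv foot_deriv_time [OF t]])
    show "((\<lambda>x. f (Y t x)) has_real_derivative Vx t x) (at x)"
      unfolding Vx_def by (rule DERIV_chain2 [OF deriv foot_deriv_space [OF t]])
    show "Vt t x = 0 * 0 - f (Y t x) * Vx t x"
      by (simp add: Vt_def Vx_def)
  qed (use per in auto)
qed

end

section \<open>The counterexample\<close>

text \<open>Without viscosity the profile is \<open>a sin (k y)\<close>. Its slope is bounded by \<open>a k\<close>, and the amplitude
  \<open>a = 1 / (2 k T)\<close> is chosen so that \<open>T a k = 1 / 2\<close>. The value at a quarter of the short period,
  where the sine is 1, witnesses that the wave is not zero.\<close>

lemma high_frequency_wave_exists:
  fixes T \<nu> :: real and k :: nat
  assumes T: "T > 0" and nu: "\<nu> \<ge> 0" and k: "k > 0"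
  obtains V where "burgers_solution \<nu> T V" "continuous_on ({0..T} \<times> UNIV) (\<lambda>(t, x). V t x)"
    "\<And>t x. t \<in> {0..T} \<Longrightarrow> V t (x + 2 * pi / real k) = V t x"
    "\<And>t x. t \<in> {0..T} \<Longrightarrow> V t (- x) = - V t x"
    "V 0 (pi / (2 * real k)) \<noteq> 0"
proof (cases "\<nu> = 0")
  case False
  then have nu: "\<nu> > 0" using nu by simp
  show ?thesis
    by (rule that [OF viscous_wave(2,1) [OF nu k]]) (use k nu in \<open>simp_all add: distrib_left\<close>)
next
  case True
  define a where "a = 1 / (2 * real k * T)"
  define f where "f = (\<lambda>y. a * sin (real k * y))"
  define f' where "f' = (\<lambda>y. a * real k * cos (real k * y))"
  define L where "L = a * real k"
  have a: "a > 0" using k T by (simp add: a_def)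
  have small: "T * L = 1 / 2"
    using k T by (simp add: L_def a_def)
  have deriv: "(f has_real_derivative f' y) (at y)" for y
    unfolding f_def f'_def by (auto intro!: derivative_eq_intros)
  have bound: "\<bar>f' y\<bar> \<le> L" for y
    using a mult_left_mono [OF abs_cos_le_one, of "a * real k"] by (simp add: f'_def L_def abs_mult)
  have lip: "\<bar>f y - f z\<bar> \<le> L * \<bar>y - z\<bar>" for y z
    using field_differentiable_bound [of UNIV f f' L y z] deriv bound by auto
  have ex1: "\<exists>!y. y + t * f y = x" if "t \<in> {0..T}" for t x
  proof (rule characteristic_foot_exists1 [OF lip])
    show "t * L \<le> 1 / 2"
    proof -
      have "t * L \<le> T * L"
        using that a by (intro mult_right_mono) (auto simp: L_def)
      then show ?thesis using small by simp
    qed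
  qed (use that in simp)
  define Y where "Y = (\<lambda>t x. THE y. y + t * f y = x)"
  have foot: "Y t x + t * f (Y t x) = x" if "t \<in> {0..T}" for t x
    unfolding Y_def by (rule theI' [OF ex1 [OF that]])
  have foot_eq: "Y t x = y" if "t \<in> {0..T}" "y + t * f y = x" for t x y
    using ex1 [OF that(1), of x] foot [OF that(1), of x] that(2) by blast
  have f_per: "f (y + 2 * pi / real k) = f y" and f_odd: "f (- y) = - f y" for y
    using k by (simp_all add: f_def distrib_left)
  \<comment> \<open>Uniqueness of the foot transports the symmetries of the initial profile.\<close>
  have Y_per: "Y t (x + 2 * pi / real k) = Y t x + 2 * pi / real k" if "t \<in> {0..T}" for t x
    by (rule foot_eq [OF that]) (use foot [OF that, of x] in \<open>simp add: f_per\<close>)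
  have Y_odd: "Y t (- x) = - Y t x" if "t \<in> {0..T}" for t x
    by (rule foot_eq [OF that]) (use foot [OF that, of x] in \<open>simp add: f_odd\<close>)
  interpret characteristics f f' L T Y
    by unfold_locales
      (use deriv bound small foot in \<open>auto simp: f'_def intro!: continuous_intros\<close>)
  have per: "f (Y t (x + 2 * pi / real k)) = f (Y t x)" if "t \<in> {0..T}" for t x
    by (simp only: Y_per [OF that] f_per)
  have per2: "f (Y t (x + 2 * pi)) = f (Y t x)" if "t \<in> {0..T}" for t x
    using periodic_iterate [of "\<lambda>x. f (Y t x)" "2 * pi / real k" x k] per [OF that] k by simp
  have "Y 0 x = x" for x
    using foot [of 0 x] T by simp
  then have "f (Y 0 (pi / (2 * real k))) \<noteq> 0"
    using a k by (simp add: f_def)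
  then show ?thesis
    using that inviscid_wave [OF per2] True per Y_odd f_odd by simp
qed

text \<open>If one function \<open>V\<close> solves both equations, then uniqueness pushes the agreement with \<open>V\<close> from time
  0 to \<open>T\<close> along each forward iterate and back to 0 along the next backward iterate.\<close>

lemma bfn_sequence_unique:
  assumes T: "T > 0" and u: "burgers_solution \<nu> T u"
    and uf: "unique_forward \<nu> \<mu> M T" and ub: "unique_backward \<nu> \<mu> M T"
    and fw: "forward_solution \<nu> \<mu> M T u V" and bw: "backward_solution \<nu> \<mu> M T u V"
    and seq: "bfn_sequence \<nu> \<mu> M T u (V 0) v w"
  shows "L2_eq (w n 0) (V 0)"
proof (induction n)
  case 0
  then show ?case using seq by (simp add: bfn_sequence_def)
next
  case (Suc n)
  have step: "forward_solution \<nu> \<mu> M T u (v (Suc n))" "L2_eq (v (Suc n) 0) (w n 0)"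
    "backward_solution \<nu> \<mu> M T u (w (Suc n))" "L2_eq (w (Suc n) T) (v (Suc n) T)"
    using seq unfolding bfn_sequence_def by force+
  have trans: "L2_eq p q \<Longrightarrow> L2_eq q r \<Longrightarrow> L2_eq p r" for p q r
    unfolding L2_eq_def by (elim AE_mp) auto
  have "L2_eq (v (Suc n) 0) (V 0)"
    using trans step(2) Suc by blast
  then have "L2_eq (v (Suc n) T) (V T)"
    using uf u fw step(1) T unfolding unique_forward_def by (metis atLeastAtMost_iff less_imp_le order_refl)
  then have "L2_eq (w (Suc n) T) (V T)"
    using trans step(4) by blast
  then show ?case
    using ub u bw step(3) T unfolding unique_backward_def by (metis atLeastAtMost_iff less_imp_le order_refl)
qed

lemma L2_norm_cong:
  assumes "L2_eq f g" "f \<in> borel_measurable lebesgue" "g \<in> borel_measurable lebesgue"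
  shows "L2_norm f = L2_norm g"
proof -
  have "(LINT x:{0..2 * pi}|lebesgue. (f x)\<^sup>2) = (LINT x:{0..2 * pi}|lebesgue. (g x)\<^sup>2)"
    unfolding set_lebesgue_integral_def
  proof (rule integral_cong_AE)
    show "AE x in lebesgue. indicat_real {0..2 * pi} x *\<^sub>R (f x)\<^sup>2 = indicat_real {0..2 * pi} x *\<^sub>R (g x)\<^sup>2"
      using assms(1) unfolding L2_eq_def by (elim AE_mp) auto
  qed (intro borel_measurable_scaleR borel_measurable_indicator borel_measurable_power assms, simp)+
  then show ?thesis by (simp add: L2_norm_def)
qed

theorem proposition3p4p4:
  fixes T \<nu> \<mu> :: real and M :: nat
  assumes "T > 0" and "\<nu> \<ge> 0" and "\<mu> \<ge> 0"
    and "unique_forward \<nu> \<mu> M T" and "unique_backward \<nu> \<mu> M T"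
  shows "\<exists>u v0. burgers_solution \<nu> T u \<and> v0 \<in> L2_per \<and>
           (\<exists>v w. bfn_sequence \<nu> \<mu> M T u v0 v w) \<and>
           (\<forall>v w. bfn_sequence \<nu> \<mu> M T u v0 v w \<longrightarrow>
              limsup (\<lambda>n. ereal (L2_norm (\<lambda>x. w n 0 x - u 0 x))) > 0)"
proof -
  define u :: "real \<Rightarrow> real \<Rightarrow> real" where "u = (\<lambda>t x. 0)"
  obtain V where V: "burgers_solution \<nu> T V"
    and cont: "continuous_on ({0..T} \<times> UNIV) (\<lambda>(t, x). V t x)"
    and per: "\<And>t x. t \<in> {0..T} \<Longrightarrow> V t (x + 2 * pi / real (Suc M)) = V t x"
    and odd: "\<And>t x. t \<in> {0..T} \<Longrightarrow> V t (- x) = - V t x"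
    and ne: "V 0 (pi / (2 * real (Suc M))) \<noteq> 0"
    using high_frequency_wave_exists [OF assms(1,2), of "Suc M"] by (metis zero_less_Suc)
  note slice = continuous_on_slice [OF cont]
  have blind: "fourier_proj M (\<lambda>y. u t y - V t y) x = 0" if "t \<in> {0..T}" for t x
    unfolding u_def
    by (rule fourier_proj_eq_0) (use slice per odd that in \<open>auto intro!: continuous_intros\<close>)
  have fw: "forward_solution \<nu> \<mu> M T u V"
    using V unfolding burgers_solution_def forward_solution_def
    by (subst forced_burgers_solution_cong [where G = "\<lambda>t x. 0"]) (use blind in auto)
  have bw: "backward_solution \<nu> \<mu> M T u V"
    using V unfolding burgers_solution_def backward_solution_def
    by (subst forced_burgers_solution_cong [where G = "\<lambda>t x. 0"]) (use blind in auto)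
  have u: "burgers_solution \<nu> T u"
    unfolding u_def by (rule burgers_solution_0)
  have zero: "0 \<in> {0..T}" using assms(1) by simp
  have V0: "V 0 \<in> L2_per"
    using V zero unfolding burgers_solution_def forced_burgers_solution_def by blast
  have "pi / (2 * real (Suc M)) \<le> pi / 1"
    by (intro divide_left_mono) auto
  also have "\<dots> \<le> 2 * pi"
    by simp
  finally have "pi / (2 * real (Suc M)) \<in> {0..2 * pi}"
    by simp
  then have pos: "L2_norm (V 0) > 0"
    using ne by (intro L2_norm_pos [OF slice [OF zero]])
  have "bfn_sequence \<nu> \<mu> M T u (V 0) (\<lambda>n. V) (\<lambda>n. V)"
    using fw bw by (simp add: bfn_sequence_def L2_eq_def)
  moreover have "limsup (\<lambda>n. ereal (L2_norm (\<lambda>x. w n 0 x - u 0 x))) > 0"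
    if seq: "bfn_sequence \<nu> \<mu> M T u (V 0) v w" for v w
  proof -
    have "L2_norm (\<lambda>x. w n 0 x - u 0 x) = L2_norm (V 0)" if "n \<ge> 1" for n
    proof -
      have "backward_solution \<nu> \<mu> M T u (w n)"
        using seq that by (simp add: bfn_sequence_def)
      then have "w n 0 \<in> L2_per"
        using zero unfolding backward_solution_def forced_burgers_solution_def by blast
      then have "L2_norm (w n 0) = L2_norm (V 0)"
        using bfn_sequence_unique [OF assms(1) u assms(4,5) fw bw seq] V0
        by (intro L2_norm_cong) (auto simp: L2_per_def)
      then show ?thesis by (simp add: u_def)
    qed
    then have "limsup (\<lambda>n. ereal (L2_norm (\<lambda>x. w n 0 x - u 0 x))) = limsup (\<lambda>n. ereal (L2_norm (V 0)))"
      by (intro Limsup_eq eventually_sequentiallyI [of 1]) simp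
    also have "\<dots> = ereal (L2_norm (V 0))"
      by (rule Limsup_const) simp
    finally show ?thesis using pos by simp
  qed
  ultimately show ?thesis
    using u V0 by blast
qed

end
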